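(* If $\mathcal{I}$ is a meager ideal on $\omega$, then there is a perfect $(\mathcal{I},\mathrm{Fin})$-AD family. In particular, if $\mathcal{I}$ is everywhere meager, then for every $X\in\mathcal{I}^+$ there is a perfect $(\mathcal{I},\mathrm{Fin})$-AD family on $X$ (i.e. one consisting of subsets of $X$).
   Context: An ideal $\mathcal{I}$ on a countably infinite set $X$ is always assumed to satisfy $[X]^{<\omega}\subseteq\mathcal{I}$ and $X\notin\mathcal{I}$; $\mathcal{I}^+=\mathcal{P}(X)\setminus\mathcal{I}$. For $Y\in\mathcal{I}^+$, $\mathcal{I}\upharpoonright Y=\{A\in\mathcal{I}:A\subseteq Y\}$, an ideal on $Y$. Topological notions (meager, perfect) for families of subsets of $X$ refer to $\mathcal{P}(X)\simeq 2^X$ with the product topology. $\mathcal{I}$ is everywhere meager if $\mathcal{I}\upharpoonright Y$ is meager in $\mathcal{P}(Y)$ for every $Y\in\mathcal{I}^+$. A nonempty family $\mathcal{A}\subseteq\mathcal{I}^+$ is $(\mathcal{I},\mathrm{Fin})$-AD if $|A\cap B|<\omega$ for every distinct $A,B\in\mathcal{A}$. A family is perfect if it is a nonempty perfect subset (closed, without isolated points). *)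

theory Defs
  imports "HOL-Analysis.Analysis"
begin

definition ideal_on :: "'a set \<Rightarrow> 'a set set \<Rightarrow> bool" where
  "ideal_on X I \<longleftrightarrow>
     countable X \<and> infinite X \<and> I \<subseteq> Pow X \<and>
     (\<forall>A\<in>I. \<forall>B. B \<subseteq> A \<longrightarrow> B \<in> I) \<and>
     (\<forall>A\<in>I. \<forall>B\<in>I. A \<union> B \<in> I) \<and>
     (\<forall>F. finite F \<and> F \<subseteq> X \<longrightarrow> F \<in> I) \<and>
     X \<notin> I"

definition positive_sets :: "'a set \<Rightarrow> 'a set set \<Rightarrow> 'a set set" where
  "positive_sets X I = Pow X - I"

definition ideal_restrict :: "'a set set \<Rightarrow> 'a set \<Rightarrow> 'a set set" where
  "ideal_restrict I Y = {A \<in> I. A \<subseteq> Y}"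

(* The topology on Pow X transported from the product 2^X of discrete two-point spaces by
   A |-> characteristic function of A. Functions in product_topology are extensional on X,
   hence the restricted lambda. *)
definition powerset_topology :: "'a set \<Rightarrow> 'a set topology" where
  "powerset_topology X =
     pullback_topology (Pow X) (\<lambda>A. \<lambda>x\<in>X. x \<in> A)
       (product_topology (\<lambda>_. discrete_topology (UNIV :: bool set)) X)"

lemma topspace_powerset_topology [simp]: "topspace (powerset_topology X) = Pow X"
  by (auto simp: powerset_topology_def topspace_pullback_topology)

definition nowhere_dense_in :: "'a topology \<Rightarrow> 'a set \<Rightarrow> bool" where
  "nowhere_dense_in T S \<longleftrightarrow> S \<subseteq> topspace T \<and> T interior_of (T closure_of S) = {}"

definition meager_in :: "'a topology \<Rightarrow> 'a set \<Rightarrow> bool" where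
  "meager_in T S \<longleftrightarrow>
     (\<exists>N :: nat \<Rightarrow> 'a set. (\<forall>n. nowhere_dense_in T (N n)) \<and> S = (\<Union>n. N n))"

definition perfect_in :: "'a topology \<Rightarrow> 'a set \<Rightarrow> bool" where
  "perfect_in T S \<longleftrightarrow> S \<noteq> {} \<and> closedin T S \<and> S \<subseteq> T derived_set_of S"

definition everywhere_meager :: "'a set \<Rightarrow> 'a set set \<Rightarrow> bool" where
  "everywhere_meager X I \<longleftrightarrow>
     (\<forall>Y \<in> positive_sets X I. meager_in (powerset_topology Y) (ideal_restrict I Y))"

(* (I, Fin)-almost disjoint families, for an ideal I on X *)
definition Fin_AD :: "'a set \<Rightarrow> 'a set set \<Rightarrow> 'a set set \<Rightarrow> bool" where
  "Fin_AD X I \<A> \<longleftrightarrow>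
     \<A> \<noteq> {} \<and> \<A> \<subseteq> positive_sets X I \<and>
     (\<forall>A\<in>\<A>. \<forall>B\<in>\<A>. A \<noteq> B \<longrightarrow> finite (A \<inter> B))"

end

theory Submission
  imports Defs
begin

text \<open>
  A meager hereditary family on an infinite set omits every set that contains infinitely many blocks
  of some sequence of pairwise disjoint finite nonempty sets (Talagrand, Jalali-Naini).
  Indexing the blocks by the finite binary strings, the union of the blocks along a branch is
  positive, two branches share only finitely many blocks, and the map from branches to unions is a
  continuous injection of Cantor space, so its range is perfect.
\<close>

section \<open>The topology of the power set: finite traces, separation, compactness\<close>

text \<open>A basic box of the product restricts finitely many coordinates, and over discrete
  two-point factors it can be shrunk to fix them. Hence neighbourhoods of \<open>A\<close> are
  described by its traces on finite sets \<open>F\<close>.\<close>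

lemma openin_powerset_topology:
  "openin (powerset_topology X) U \<longleftrightarrow>
     U \<subseteq> Pow X \<and>
     (\<forall>A\<in>U. \<exists>F. finite F \<and> F \<subseteq> X \<and> (\<forall>B. B \<subseteq> X \<and> B \<inter> F = A \<inter> F \<longrightarrow> B \<in> U))"
  (is "?l \<longleftrightarrow> ?r")
proof
  assume ?l
  then obtain W where W: "openin (product_topology (\<lambda>_. discrete_topology (UNIV :: bool set)) X) W"
    and U: "U = (\<lambda>A. \<lambda>x\<in>X. x \<in> A) -` W \<inter> Pow X"
    by (auto simp: powerset_topology_def openin_pullback_topology)
  show ?r
  proof (intro conjI ballI)
    show "U \<subseteq> Pow X" using U by blast
    fix A assume A: "A \<in> U"
    then have A_W: "(\<lambda>x\<in>X. x \<in> A) \<in> W" using U by blast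
    from W[unfolded openin_product_topology_alt, rule_format, OF A_W] obtain V where V: "finite {i \<in> X. V i \<noteq> (UNIV :: bool set)}"
      "(\<lambda>x\<in>X. x \<in> A) \<in> Pi\<^sub>E X V" "Pi\<^sub>E X V \<subseteq> W"
      unfolding topspace_discrete_topology by (elim exE conjE)
    \<comment> \<open>The coordinates that the box really restricts; agreeing with \<open>A\<close>
      there is enough to stay in the box.\<close>
    let ?F = "{i \<in> X. V i \<noteq> (UNIV :: bool set)}"
    have "B \<in> U" if B: "B \<subseteq> X" "B \<inter> ?F = A \<inter> ?F" for B
    proof -
      have "(x \<in> B) \<in> V x" if x: "x \<in> X" for x
      proof (cases "x \<in> ?F")
        case True
        then have "(x \<in> B) = (x \<in> A)" using B(2) by blast
        moreover have "(x \<in> A) \<in> V x" using V(2) x by (auto simp: PiE_iff)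
        ultimately show ?thesis by simp
      qed (use x in auto)
      then have "(\<lambda>x\<in>X. x \<in> B) \<in> Pi\<^sub>E X V" by auto
      then show ?thesis using V(3) U B(1) by blast
    qed
    with V(1) show "\<exists>F. finite F \<and> F \<subseteq> X \<and> (\<forall>B. B \<subseteq> X \<and> B \<inter> F = A \<inter> F \<longrightarrow> B \<in> U)"
      by (intro exI[of _ ?F]) blast
  qed
next
  assume r: ?r
  \<comment> \<open>The characteristic functions of the members of \<open>U\<close>, taken
    extensional so that they are points of the product.\<close>
  let ?W = "{g \<in> extensional X. {x \<in> X. g x} \<in> U}"
  have "openin (product_topology (\<lambda>_. discrete_topology (UNIV :: bool set)) X) ?W"
    unfolding openin_product_topology_alt
  proof
    fix g assume g: "g \<in> ?W"
    then have "{x \<in> X. g x} \<in> U" by simp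
    from conjunct2[OF r, rule_format, OF this] obtain F where F: "finite F" "F \<subseteq> X"
      "\<forall>B. B \<subseteq> X \<and> B \<inter> F = {x \<in> X. g x} \<inter> F \<longrightarrow> B \<in> U"
      by (elim exE conjE)
    let ?V = "\<lambda>i. if i \<in> F then {g i} else UNIV"
    have "finite {i \<in> X. ?V i \<noteq> topspace (discrete_topology (UNIV :: bool set))}"
      by (rule finite_subset[OF _ F(1)]) auto
    moreover have "g \<in> Pi\<^sub>E X ?V" using g by (auto simp: PiE_iff)
    moreover have "Pi\<^sub>E X ?V \<subseteq> ?W"
    proof
      fix h assume h: "h \<in> Pi\<^sub>E X ?V"
      have "h x = g x" if "x \<in> F" for x
        using h that F(2) by (auto simp: PiE_iff subset_iff split: if_splits)
      then have "{x \<in> X. h x} \<in> U" by (intro F(3)[rule_format]) auto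
      then show "h \<in> ?W" using h by (auto simp: PiE_iff)
    qed
    ultimately show "\<exists>V. finite {i \<in> X. V i \<noteq> topspace (discrete_topology (UNIV :: bool set))} \<and>
        (\<forall>i\<in>X. openin (discrete_topology UNIV) (V i)) \<and> g \<in> Pi\<^sub>E X V \<and> Pi\<^sub>E X V \<subseteq> ?W"
      by (intro exI[of _ ?V]) auto
  qed
  moreover have "U = (\<lambda>A. \<lambda>x\<in>X. x \<in> A) -` ?W \<inter> Pow X"
  proof (rule set_eqI)
    fix A
    have "{x \<in> X. (\<lambda>x\<in>X. x \<in> A) x} = X \<inter> A" by auto
    then have W: "A \<in> (\<lambda>A. \<lambda>x\<in>X. x \<in> A) -` ?W \<longleftrightarrow> X \<inter> A \<in> U" by simp
    show "A \<in> U \<longleftrightarrow> A \<in> (\<lambda>A. \<lambda>x\<in>X. x \<in> A) -` ?W \<inter> Pow X"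
    proof (cases "A \<subseteq> X")
      case True
      then have "X \<inter> A = A" by blast
      with W True show ?thesis by (simp only: Int_iff Pow_iff simp_thms)
    next
      case False
      then show ?thesis using r by blast
    qed
  qed
  ultimately show ?l
    unfolding powerset_topology_def openin_pullback_topology by blast
qed

lemma openin_powerset_topologyE:
  assumes "openin (powerset_topology X) U" "A \<in> U"
  obtains F where "finite F" "F \<subseteq> X"
    "\<And>B. B \<subseteq> X \<Longrightarrow> B \<inter> F = A \<inter> F \<Longrightarrow> B \<in> U"
proof -
  from assms have "\<exists>F. finite F \<and> F \<subseteq> X \<and> (\<forall>B. B \<subseteq> X \<and> B \<inter> F = A \<inter> F \<longrightarrow> B \<in> U)"
    unfolding openin_powerset_topology by (elim conjE bspec)
  then show thesis using that by (elim exE conjE) simp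
qed

lemma openin_powerset_cylinder:
  assumes "finite F" "F \<subseteq> X"
  shows "openin (powerset_topology X) {A. A \<subseteq> X \<and> A \<inter> F = S}"
  unfolding openin_powerset_topology using assms by blast

lemma Hausdorff_space_powerset_topology: "Hausdorff_space (powerset_topology X)"
  unfolding Hausdorff_space_def
proof (intro allI impI, elim conjE)
  fix A B assume AB: "A \<in> topspace (powerset_topology X)" "B \<in> topspace (powerset_topology X)" "A \<noteq> B"
  then obtain x where x: "x \<in> X" "x \<in> A \<longleftrightarrow> x \<notin> B" by auto
  have "openin (powerset_topology X) {C. C \<subseteq> X \<and> C \<inter> {x} = S}" for S
    using x by (intro openin_powerset_cylinder) auto
  moreover have "disjnt {C. C \<subseteq> X \<and> C \<inter> {x} = A \<inter> {x}} {C. C \<subseteq> X \<and> C \<inter> {x} = B \<inter> {x}}"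
    using x by (auto simp: disjnt_def)
  ultimately show "\<exists>U V. openin (powerset_topology X) U \<and> openin (powerset_topology X) V \<and>
      A \<in> U \<and> B \<in> V \<and> disjnt U V"
    using AB
    by (intro exI[of _ "{C. C \<subseteq> X \<and> C \<inter> {x} = A \<inter> {x}}"]
        exI[of _ "{C. C \<subseteq> X \<and> C \<inter> {x} = B \<inter> {x}}"]) auto
qed

text \<open>By Tychonoff the product is compact, and \<open>Pow X\<close> is its continuous image
  under \<open>?f\<close>, the inverse of the characteristic-function map.\<close>

lemma compact_space_powerset_topology: "compact_space (powerset_topology X)"
proof -
  let ?P = "product_topology (\<lambda>_. discrete_topology (UNIV :: bool set)) X"
  let ?f = "\<lambda>g. {x \<in> X. g x}"
  have "compact_space ?P"
    by (simp add: compact_space_product_topology compact_space_discrete_topology)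
  moreover have "continuous_map ?P (powerset_topology X) ?f"
    unfolding powerset_topology_def
  proof (rule continuous_map_pullback')
    show "continuous_map ?P ?P ((\<lambda>A. \<lambda>x\<in>X. x \<in> A) \<circ> ?f)"
      by (rule continuous_map_eq[OF continuous_map_id])
        (auto simp: PiE_iff extensional_def fun_eq_iff)
  qed auto
  ultimately have "compactin (powerset_topology X) (?f ` topspace ?P)"
    by (simp add: image_compactin compact_space_def)
  moreover have "?f ` topspace ?P = Pow X"
  proof (intro equalityI subsetI)
    fix A assume "A \<in> Pow X"
    show "A \<in> ?f ` topspace ?P"
    proof (rule image_eqI)
      show "A = ?f (\<lambda>x\<in>X. x \<in> A)" using \<open>A \<in> Pow X\<close> by auto
      show "(\<lambda>x\<in>X. x \<in> A) \<in> topspace ?P" by simp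
    qed
  qed auto
  ultimately show ?thesis by (simp add: compact_space_def)
qed

section \<open>Finite blocks that defeat a meager hereditary family\<close>

text \<open>Nowhere density as a forcing statement: the cylinder of trace \<open>S\<close> on
  \<open>E\<close> is nonempty and open, so it has a point outside the closure of \<open>N\<close>.
  A finite trace of that point already keeps sets off the closure, and joined with \<open>E\<close>
  it refines the condition.\<close>

lemma nowhere_dense_in_powerset_extend:
  assumes N: "nowhere_dense_in (powerset_topology X) N"
    and E: "finite E" "E \<subseteq> X" "S \<subseteq> E"
  obtains E' S' where "finite E'" "E \<subseteq> E'" "E' \<subseteq> X" "S' \<inter> E = S" "S' \<subseteq> E'"
    "\<And>A. A \<subseteq> X \<Longrightarrow> A \<inter> E' = S' \<Longrightarrow> A \<notin> N"
proof -
  let ?T = "powerset_topology X"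
  let ?U = "{A. A \<subseteq> X \<and> A \<inter> E = S}"
  have N': "N \<subseteq> Pow X" "?T interior_of (?T closure_of N) = {}"
    using N by (auto simp: nowhere_dense_in_def)
  have "\<not> ?U \<subseteq> ?T closure_of N"
  proof
    assume "?U \<subseteq> ?T closure_of N"
    moreover have "openin ?T ?U" by (rule openin_powerset_cylinder) (use E in auto)
    ultimately have "?U \<subseteq> {}" unfolding N'(2)[symmetric] by (rule interior_of_maximal)
    moreover have "S \<in> ?U" using E by auto
    ultimately show False by blast
  qed
  then obtain A where A: "A \<subseteq> X" "A \<inter> E = S" "A \<in> Pow X - ?T closure_of N" by auto
  have "openin ?T (Pow X - ?T closure_of N)"
    using closedin_closure_of[of ?T N] by (auto simp: closedin_def)
  from this A(3) obtain F where F: "finite F" "F \<subseteq> X"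
    "\<And>B. B \<subseteq> X \<Longrightarrow> B \<inter> F = A \<inter> F \<Longrightarrow> B \<in> Pow X - ?T closure_of N"
    by (rule openin_powerset_topologyE) blast
  have "N \<subseteq> ?T closure_of N" using N'(1) by (simp add: closure_of_subset)
  then have "B \<notin> N" if "B \<subseteq> X" "B \<inter> (E \<union> F) = A \<inter> (E \<union> F)" for B
    using F(3)[of B] that by blast
  then show thesis
    using that[of "E \<union> F" "A \<inter> (E \<union> F)"] E F A by blast
qed

text \<open>A pair \<open>(k, R)\<close> is a demand: sets with trace \<open>R\<close> on
  \<open>E\<close> must be kept out of \<open>N k\<close>. Finitely many demands are met one after
  another, each time extending the pattern outside \<open>E\<close> found so far.\<close>

lemma nowhere_dense_in_powerset_finite_block:
  assumes N: "\<And>k. nowhere_dense_in (powerset_topology X) (N k)"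
    and E: "finite E" "E \<subseteq> X" and P: "finite P" "P \<subseteq> UNIV \<times> Pow E"
  shows "\<exists>G S. finite G \<and> G \<subseteq> X - E \<and> S \<subseteq> G \<and>
    (\<forall>(k, R)\<in>P. \<forall>A. A \<subseteq> X \<and> A \<inter> E = R \<and> A \<inter> G = S \<longrightarrow> A \<notin> N k)"
  using P
proof (induction rule: finite_induct)
  case empty
  show ?case by (rule exI[of _ "{}"]) auto
next
  case (insert p P)
  obtain k R where p: "p = (k, R)" "R \<subseteq> E" using insert.prems by auto
  have "P \<subseteq> UNIV \<times> Pow E" using insert.prems by blast
  from insert.IH[OF this] obtain G S where G: "finite G" "G \<subseteq> X - E" "S \<subseteq> G"
    "\<forall>(k, R)\<in>P. \<forall>A. A \<subseteq> X \<and> A \<inter> E = R \<and> A \<inter> G = S \<longrightarrow> A \<notin> N k"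
    by (elim exE conjE)
  \<comment> \<open>The new demand is met starting from the trace \<open>R\<close> on
    \<open>E\<close> together with the old pattern \<open>S\<close> on \<open>G\<close>. Since
    \<open>G\<close> is disjoint from \<open>E\<close>, dropping \<open>E\<close> from
    \<open>S'\<close> keeps \<open>S\<close> on \<open>G\<close>, and so the old demands stay
    met.\<close>
  obtain E' S' where E': "finite E'" "E \<union> G \<subseteq> E'" "E' \<subseteq> X" "S' \<inter> (E \<union> G) = R \<union> S" "S' \<subseteq> E'"
    "\<And>A. A \<subseteq> X \<Longrightarrow> A \<inter> E' = S' \<Longrightarrow> A \<notin> N k"
    by (rule nowhere_dense_in_powerset_extend[where N = "N k" and E = "E \<union> G" and S = "R \<union> S", OF N]) (use E G p in auto)
  have "A \<notin> N j" if "(j, Q) \<in> insert p P" "A \<subseteq> X" "A \<inter> E = Q" "A \<inter> (E' - E) = S' - E" for j Q A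
  proof (cases "(j, Q) = p")
    case True
    moreover have "S' \<inter> E = R" using E'(4) G(2,3) p(2) by blast
    ultimately have "S' \<inter> E = A \<inter> E" using that(3) p(1) by simp
    then have "A \<inter> E' = S'" using that(4) E'(2,5) by blast
    then show ?thesis using E'(6)[of A] that(2) True p(1) by simp
  next
    case False
    moreover have "A \<inter> G = S" using that(4) E'(2,4) G(2,3) p(2) by blast
    ultimately show ?thesis using G(4) that by blast
  qed
  then show ?case
    using E'(1,3,5) by (intro exI[of _ "E' - E"] exI[of _ "S' - E"]) auto
qed

text \<open>Every set has one of the finitely many traces on \<open>E\<close>. Meeting the demands
  for all of them makes the pattern on \<open>G\<close> alone decisive, whatever happens on
  \<open>E\<close>.\<close>

lemma nowhere_dense_in_powerset_block:
  fixes N :: "nat \<Rightarrow> 'a set set"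
  assumes N: "\<And>k. nowhere_dense_in (powerset_topology X) (N k)"
    and E: "finite E" "E \<subseteq> X" and X: "infinite X"
  shows "\<exists>G S. finite G \<and> G \<subseteq> X - E \<and> G \<noteq> {} \<and> S \<subseteq> G \<and>
    (\<forall>k\<le>n. \<forall>A. A \<subseteq> X \<and> A \<inter> G = S \<longrightarrow> A \<notin> N k)"
proof -
  have "finite ({..n} \<times> Pow E)" "{..n} \<times> Pow E \<subseteq> UNIV \<times> Pow E" using E by auto
  then obtain G S where G: "finite G" "G \<subseteq> X - E" "S \<subseteq> G"
    "\<forall>(k, R)\<in>{..n} \<times> Pow E. \<forall>A. A \<subseteq> X \<and> A \<inter> E = R \<and> A \<inter> G = S \<longrightarrow> A \<notin> N k"
    using nowhere_dense_in_powerset_finite_block[where N = N, OF N E] by meson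
  \<comment> \<open>Adding \<open>x\<close> to the block makes it nonempty; \<open>S\<close> does
    not contain \<open>x\<close>, so the pattern is unchanged.\<close>
  obtain x where x: "x \<in> X - E" "x \<notin> G"
    using X E G(1) by (metis Diff_infinite_finite ex_new_if_finite finite_Diff2 finite_subset subsetI)
  have "A \<notin> N k" if "k \<le> n" "A \<subseteq> X" "A \<inter> insert x G = S" for k A
  proof -
    have "A \<inter> G = S" using that(3) x G(3) by blast
    then show ?thesis using G(4) that by blast
  qed
  then show ?thesis
    by (intro exI[of _ "insert x G"] exI[of _ S]) (use G x in auto)
qed

text \<open>Block \<open>n\<close> carries a pattern \<open>S n\<close> that excludes a set from
  \<open>N 0\<close>, ..., \<open>N n\<close>. A set containing infinitely many blocks has a subset
  realizing the pattern on each of these blocks. That subset escapes every \<open>N k\<close>, and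
  heredity excludes the larger set.\<close>

lemma meager_hereditary_omits_blocks:
  assumes X: "infinite X" and J: "meager_in (powerset_topology X) J"
    and hereditary: "\<And>A B. A \<in> J \<Longrightarrow> B \<subseteq> A \<Longrightarrow> B \<in> J"
  obtains G :: "nat \<Rightarrow> 'a set" where
    "\<And>n. finite (G n)" "\<And>n. G n \<subseteq> X" "\<And>n. G n \<noteq> {}" "disjoint_family G"
    "\<And>A. infinite {n. G n \<subseteq> A} \<Longrightarrow> A \<subseteq> X \<Longrightarrow> A \<notin> J"
proof -
  obtain N :: "nat \<Rightarrow> 'a set set" where N: "\<And>k. nowhere_dense_in (powerset_topology X) (N k)"
    and J_eq: "J = (\<Union>k. N k)"
    using J by (auto simp: meager_in_def)
  define good where "good E n G S \<longleftrightarrow> finite G \<and> G \<subseteq> X - E \<and> G \<noteq> {} \<and> S \<subseteq> G \<and>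
    (\<forall>k\<le>n. \<forall>A. A \<subseteq> X \<and> A \<inter> G = S \<longrightarrow> A \<notin> N k)" for E G S and n :: nat
  have "\<exists>G S. good E n G S" if "finite E" "E \<subseteq> X" for E n
    unfolding good_def by (rule nowhere_dense_in_powerset_block) (use N that X in auto)
  then obtain g s where gs: "\<And>E n. finite E \<Longrightarrow> E \<subseteq> X \<Longrightarrow> good E n (g E n) (s E n)"
    by metis
  \<comment> \<open>\<open>E n\<close> collects the blocks with index below \<open>n\<close>.
    Choosing block \<open>n\<close> outside \<open>E n\<close> makes the blocks disjoint.\<close>
  define E where "E = rec_nat {} (\<lambda>n e. e \<union> g e n)"
  have E_Suc: "E (Suc n) = E n \<union> g (E n) n" for n by (simp add: E_def)
  have E: "finite (E n) \<and> E n \<subseteq> X" for n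
  proof (induction n)
    case 0 show ?case by (simp add: E_def)
  next
    case (Suc n)
    then show ?case using gs[of "E n" n] by (auto simp: E_Suc good_def)
  qed
  define G where "G n = g (E n) n" for n
  define S where "S n = s (E n) n" for n
  have good: "good (E n) n (G n) (S n)" for n
    using gs E by (simp add: G_def S_def)
  have mono: "E m \<subseteq> E n" if "m \<le> n" for m n
    using that by (rule lift_Suc_mono_le[rotated]) (auto simp: E_Suc)
  have lt: "G m \<inter> G n = {}" if "m < n" for m n
  proof -
    have "G m \<subseteq> E n" using mono[of "Suc m" n] that by (auto simp: E_Suc G_def)
    then show ?thesis using good[of n] by (auto simp: good_def)
  qed
  then have disj: "G m \<inter> G n = {}" if "m \<noteq> n" for m n
    using that by (metis inf_commute linorder_neqE_nat)
  have "A \<notin> J" if inf: "infinite {n. G n \<subseteq> A}" and A: "A \<subseteq> X" for A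
  proof
    assume "A \<in> J"
    \<comment> \<open>Only the patterns of blocks inside \<open>A\<close> are used, so
      \<open>B\<close> stays below \<open>A\<close>; disjointness of the blocks prevents one pattern
      from disturbing another.\<close>
    define B where "B = (\<Union>n\<in>{n. G n \<subseteq> A}. S n)"
    have S: "S n \<subseteq> G n" for n using good by (simp add: good_def)
    have "B \<subseteq> A" using S by (force simp: B_def)
    then obtain k where k: "B \<in> N k" using hereditary \<open>A \<in> J\<close> J_eq by blast
    \<comment> \<open>The index must be at least \<open>k\<close>, because block \<open>n\<close>
      only handles \<open>N 0\<close> up to \<open>N n\<close>.\<close>
    obtain n where n: "n \<ge> k" "G n \<subseteq> A"
      using inf unfolding infinite_nat_iff_unbounded_le by auto
    have "B \<inter> G n = S n"
    proof
      show "S n \<subseteq> B \<inter> G n" using n S by (auto simp: B_def)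
      show "B \<inter> G n \<subseteq> S n"
      proof
        fix x assume x: "x \<in> B \<inter> G n"
        then obtain m where "x \<in> S m" by (auto simp: B_def)
        then show "x \<in> S n" using x S disj[of m n] by (cases "m = n") auto
      qed
    qed
    then show False using good[of n] n(1) k \<open>B \<subseteq> A\<close> A by (auto simp: good_def)
  qed
  moreover have "disjoint_family G" using disj by (auto simp: disjoint_family_on_def)
  moreover have "finite (G n)" "G n \<subseteq> X" "G n \<noteq> {}" for n
    using good[of n] by (auto simp: good_def)
  ultimately show thesis using that[of G] by simp
qed

section \<open>Branches of the binary tree and the unions of blocks along them\<close>

text \<open>A branch is a set \<open>Z\<close>, and its node at level \<open>n\<close> is the
  initial segment of length \<open>n\<close> of its characteristic function. Numbering the nodes by
  \<open>to_nat\<close> lets a sequence of blocks serve as a family of blocks indexed by the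
  tree.\<close>

definition branch_code :: "nat set \<Rightarrow> nat \<Rightarrow> nat" where
  "branch_code Z n = to_nat (map (\<lambda>i. i \<in> Z) [0..<n])"

lemma branch_code_eq_iff:
  "branch_code Z m = branch_code Y n \<longleftrightarrow> m = n \<and> Z \<inter> {..<n} = Y \<inter> {..<n}"
proof -
  have "branch_code Z m = branch_code Y n \<longleftrightarrow> map (\<lambda>i. i \<in> Z) [0..<m] = map (\<lambda>i. i \<in> Y) [0..<n]"
    by (simp add: branch_code_def)
  also have "\<dots> \<longleftrightarrow> m = n \<and> (\<forall>i<n. i \<in> Z \<longleftrightarrow> i \<in> Y)"
    by (auto simp: list_eq_iff_nth_eq)
  finally show ?thesis by auto
qed

lemma inj_branch_code: "inj (branch_code Z)"
  by (rule injI) (simp add: branch_code_eq_iff)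

text \<open>Finitely many strings have codes below \<open>M\<close>. The bound is uniform in
  \<open>Z\<close>, which is what continuity of \<open>branch_union\<close> requires.\<close>

lemma branch_code_length_bound: "\<exists>L. \<forall>Z n. branch_code Z n < M \<longrightarrow> n \<le> L"
proof -
  let ?len = "\<lambda>k. length (from_nat k :: bool list)"
  \<comment> \<open>The maximum runs over everything decoded from numbers below \<open>M\<close>,
    since \<open>from_nat\<close> recovers a string from its code. For \<open>M = 0\<close> the
    claim is vacuous.\<close>
  have "n \<le> Max (?len ` {..<M})" if "branch_code Z n < M" for Z n
  proof -
    have "n = ?len (branch_code Z n)" by (simp add: branch_code_def)
    then have "n \<in> ?len ` {..<M}" using that by blast
    then show ?thesis by simp
  qed
  then show ?thesis by blast
qed

definition branch_union :: "(nat \<Rightarrow> 'a set) \<Rightarrow> nat set \<Rightarrow> 'a set" where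
  "branch_union G Z = (\<Union>n. G (branch_code Z n))"

lemma infinite_blocks_in_branch_union: "infinite {k. G k \<subseteq> branch_union G Z}"
proof (rule infinite_super)
  show "range (branch_code Z) \<subseteq> {k. G k \<subseteq> branch_union G Z}"
    by (auto simp: branch_union_def)
  show "infinite (range (branch_code Z))"
    by (rule range_inj_infinite[OF inj_branch_code])
qed

text \<open>By disjointness a common point lies in a block that both branches use, hence at a common
  node. Branches that differ at \<open>m\<close> share nodes only up to level
  \<open>m\<close>.\<close>

lemma finite_branch_union_Int:
  assumes fin: "\<And>n. finite (G n)" and disj: "disjoint_family G" and "Y \<noteq> Z"
  shows "finite (branch_union G Y \<inter> branch_union G Z)"
proof -
  obtain m where m: "m \<in> Y \<longleftrightarrow> m \<notin> Z" using \<open>Y \<noteq> Z\<close> by auto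
  \<comment> \<open>Level \<open>m\<close> is included: a node of length \<open>m\<close> records
    only membership of numbers below \<open>m\<close>.\<close>
  have "branch_union G Y \<inter> branch_union G Z \<subseteq> (\<Union>n\<le>m. G (branch_code Y n))"
  proof
    fix x assume "x \<in> branch_union G Y \<inter> branch_union G Z"
    then obtain i j where ij: "x \<in> G (branch_code Y i)" "x \<in> G (branch_code Z j)"
      by (auto simp: branch_union_def)
    then have "branch_code Y i = branch_code Z j"
      using disj by (auto simp: disjoint_family_on_def)
    then have "Y \<inter> {..<i} = Z \<inter> {..<i}" by (simp add: branch_code_eq_iff)
    then have "m \<notin> {..<i}" using m by blast
    then have "i \<le> m" by simp
    then show "x \<in> (\<Union>n\<le>m. G (branch_code Y n))" using ij by auto
  qed
  then show ?thesis by (rule finite_subset) (use fin in auto)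
qed

lemma infinite_branch_union:
  assumes ne: "\<And>n. G n \<noteq> {}" and disj: "disjoint_family G"
  shows "infinite (branch_union G Z)"
proof -
  obtain p where p: "\<And>n. p n \<in> G n" using ne by (meson all_not_in_conv)
  have "inj p"
    using p disj by (auto simp: inj_def disjoint_family_on_def) (metis IntI empty_iff)
  then have "inj (p \<circ> branch_code Z)" by (rule inj_compose[OF _ inj_branch_code])
  moreover have "range (p \<circ> branch_code Z) \<subseteq> branch_union G Z"
    using p by (auto simp: branch_union_def)
  ultimately show ?thesis using infinite_super range_inj_infinite by blast
qed

text \<open>If distinct branches had the same union, this infinite set would equal its own finite
  intersection with itself.\<close>

lemma inj_branch_union:
  assumes "\<And>n. finite (G n)" "\<And>n. G n \<noteq> {}" "disjoint_family G"
  shows "inj (branch_union G)"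
  using finite_branch_union_Int[OF assms(1,3)] infinite_branch_union[OF assms(2,3)]
  by (metis injI inf.idem)

text \<open>A finite set \<open>F\<close> meets finitely many blocks, the nodes of these blocks have
  bounded length, and so the trace of \<open>branch_union G Z\<close> on \<open>F\<close> is
  determined by a finite initial part of \<open>Z\<close>.\<close>

lemma continuous_map_branch_union:
  assumes sub: "\<And>n. G n \<subseteq> X" and disj: "disjoint_family G"
  shows "continuous_map (powerset_topology UNIV) (powerset_topology X) (branch_union G)"
proof -
  have sub': "branch_union G Z \<subseteq> X" for Z using sub by (auto simp: branch_union_def)
  have "openin (powerset_topology UNIV) {Z. branch_union G Z \<in> U}"
    if U: "openin (powerset_topology X) U" for U
    unfolding openin_powerset_topology
  proof (intro conjI ballI)
    fix Z assume "Z \<in> {Z. branch_union G Z \<in> U}"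
    then have "branch_union G Z \<in> U" by simp
    with U obtain F where F: "finite F"
      "\<And>B. B \<subseteq> X \<Longrightarrow> B \<inter> F = branch_union G Z \<inter> F \<Longrightarrow> B \<in> U"
      by (rule openin_powerset_topologyE) blast
    have "finite {k. x \<in> G k}" for x
    proof (cases "\<exists>k. x \<in> G k")
      case True
      then obtain k where "x \<in> G k" by blast
      then have "{k. x \<in> G k} \<subseteq> {k}" using disj by (auto simp: disjoint_family_on_def)
      then show ?thesis by (rule finite_subset) simp
    qed simp
    then have "finite (\<Union>x\<in>F. {k. x \<in> G k})" using F(1) by blast
    then obtain M where M: "\<And>x k. x \<in> F \<Longrightarrow> x \<in> G k \<Longrightarrow> k < M"
      by (auto simp: finite_nat_set_iff_bounded)
    obtain L where L: "\<And>Z n. branch_code Z n < M \<Longrightarrow> n \<le> L"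
      using branch_code_length_bound by blast
    \<comment> \<open>Only one inclusion of traces is shown; exchanging \<open>Y\<close> and
      \<open>Y'\<close> gives the other.\<close>
    have agree: "x \<in> branch_union G Y'"
      if eq: "Y \<inter> {..<L} = Y' \<inter> {..<L}" and x: "x \<in> F" "x \<in> branch_union G Y" for Y Y' x
    proof -
      obtain n where n: "x \<in> G (branch_code Y n)" using x by (auto simp: branch_union_def)
      then have "n \<le> L" using M[OF x(1)] by (intro L)
      then have "{..<n} = {..<L} \<inter> {..<n}" by auto
      then have "Y \<inter> {..<n} = Y' \<inter> {..<n}" using eq by (metis Int_assoc)
      then have "branch_code Y n = branch_code Y' n" by (simp add: branch_code_eq_iff)
      then show ?thesis using n by (auto simp: branch_union_def)
    qed
    have "branch_union G Y \<in> U" if "Y \<inter> {..<L} = Z \<inter> {..<L}" for Y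
    proof (rule F(2)[OF sub'])
      show "branch_union G Y \<inter> F = branch_union G Z \<inter> F"
        using agree[OF that] agree[OF that[symmetric]] by blast
    qed
    then show "\<exists>F. finite F \<and> F \<subseteq> UNIV \<and>
        (\<forall>B. B \<subseteq> UNIV \<and> B \<inter> F = Z \<inter> F \<longrightarrow> B \<in> {Z. branch_union G Z \<in> U})"
      by (intro exI[of _ "{..<L}"]) auto
  qed simp
  then show ?thesis using sub' by (auto simp: continuous_map_def)
qed

section \<open>Perfect families from injective images of Cantor space\<close>

text \<open>The range is compact in a Hausdorff space, hence closed. Cantor space has no isolated
  points, and injectivity carries this over to the range.\<close>

lemma perfect_in_injective_image:
  assumes cont: "continuous_map (powerset_topology UNIV) (powerset_topology X) f"
    and inj: "inj (f :: nat set \<Rightarrow> 'a set)"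
  shows "perfect_in (powerset_topology X) (range f)"
  unfolding perfect_in_def
proof (intro conjI subsetI)
  show "range f \<noteq> {}" by simp
  have "compactin (powerset_topology X) (f ` topspace (powerset_topology UNIV))"
    using compact_space_powerset_topology cont image_compactin unfolding compact_space_def by blast
  then show "closedin (powerset_topology X) (range f)"
    using compactin_imp_closedin[OF Hausdorff_space_powerset_topology] by simp
  fix A assume "A \<in> range f"
  then obtain Z where Z: "A = f Z" by blast
  have "\<exists>B. B \<noteq> A \<and> B \<in> range f \<and> B \<in> U" if "A \<in> U" "openin (powerset_topology X) U" for U
  proof -
    have "openin (powerset_topology UNIV) {Y. f Y \<in> U}"
      using cont that(2) by (auto simp: continuous_map_def)
    moreover have "Z \<in> {Y. f Y \<in> U}" using that(1) Z by simp
    ultimately obtain F where F: "finite F" "\<And>Y. Y \<inter> F = Z \<inter> F \<Longrightarrow> f Y \<in> U"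
      by (rule openin_powerset_topologyE) simp
    obtain m where m: "m \<notin> F" using F(1) ex_new_if_finite infinite_UNIV_nat by blast
    \<comment> \<open>Membership of the single number \<open>m\<close> is flipped; as
      \<open>m\<close> lies outside \<open>F\<close>, the trace on \<open>F\<close> and hence the
      neighbourhood are kept.\<close>
    define Y where "Y = (if m \<in> Z then Z - {m} else insert m Z)"
    have "Y \<noteq> Z" by (auto simp: Y_def)
    then have "f Y \<noteq> A" using inj Z by (simp add: inj_eq)
    moreover have "f Y \<in> U" by (rule F(2)) (use m in \<open>auto simp: Y_def\<close>)
    ultimately show ?thesis by blast
  qed
  moreover have "A \<in> topspace (powerset_topology X)"
    using cont Z by (auto simp: continuous_map_def)
  ultimately show "A \<in> powerset_topology X derived_set_of range f"
    unfolding in_derived_set_of by (intro conjI allI impI) simp_all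
qed

text \<open>The family is the range of \<open>branch_union G\<close> for the blocks \<open>G\<close>
  that defeat \<open>J\<close>. Stated for an arbitrary ground set \<open>X\<close>, it applies to
  an ideal as well as to its restriction to a positive set.\<close>

lemma perfect_almost_disjoint_family:
  assumes X: "infinite X" and J: "meager_in (powerset_topology X) J"
    and hereditary: "\<And>A B. A \<in> J \<Longrightarrow> B \<subseteq> A \<Longrightarrow> B \<in> J"
  obtains \<A> where "\<A> \<subseteq> Pow X" "\<A> \<inter> J = {}"
    "\<And>A B. A \<in> \<A> \<Longrightarrow> B \<in> \<A> \<Longrightarrow> A \<noteq> B \<Longrightarrow> finite (A \<inter> B)"
    "perfect_in (powerset_topology X) \<A>"
proof (rule meager_hereditary_omits_blocks[OF X J])
  show "B \<in> J" if "A \<in> J" "B \<subseteq> A" for A B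
    by (rule hereditary[OF that])
next
  fix G :: "nat \<Rightarrow> 'a set"
  assume G: "\<And>n. finite (G n)" "\<And>n. G n \<subseteq> X" "\<And>n. G n \<noteq> {}" "disjoint_family G"
    "\<And>A. infinite {n. G n \<subseteq> A} \<Longrightarrow> A \<subseteq> X \<Longrightarrow> A \<notin> J"
  have sub: "branch_union G Z \<subseteq> X" for Z using G(2) by (auto simp: branch_union_def)
  have notin: "branch_union G Z \<notin> J" for Z
    by (rule G(5)[OF infinite_blocks_in_branch_union sub])
  have "finite (A \<inter> B)"
    if AB: "A \<in> range (branch_union G)" "B \<in> range (branch_union G)" "A \<noteq> B" for A B
  proof -
    obtain Y Z where YZ: "A = branch_union G Y" "B = branch_union G Z" using AB(1,2) by blast
    then have "Y \<noteq> Z" using AB(3) by blast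
    then show ?thesis unfolding YZ by (rule finite_branch_union_Int[OF G(1,4)])
  qed
  moreover have "perfect_in (powerset_topology X) (range (branch_union G))"
    by (intro perfect_in_injective_image continuous_map_branch_union inj_branch_union G)
  moreover have "range (branch_union G) \<subseteq> Pow X" using sub by blast
  moreover have "range (branch_union G) \<inter> J = {}" using notin by blast
  ultimately show thesis using that by simp
qed

theorem corollary1p8:
  fixes I :: "nat set set"
  assumes "ideal_on UNIV I"
  shows "(meager_in (powerset_topology UNIV) I \<longrightarrow>
            (\<exists>\<A>. Fin_AD UNIV I \<A> \<and> perfect_in (powerset_topology UNIV) \<A>)) \<and>
         (everywhere_meager UNIV I \<longrightarrow>
            (\<forall>X \<in> positive_sets UNIV I.
               \<exists>\<A>. \<A> \<subseteq> Pow X \<and> Fin_AD UNIV I \<A> \<and> perfect_in (powerset_topology X) \<A>))"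
proof -
  have her: "\<And>A B. A \<in> I \<Longrightarrow> B \<subseteq> A \<Longrightarrow> B \<in> I" and fin: "\<And>F. finite F \<Longrightarrow> F \<in> I"
    using assms by (auto simp: ideal_on_def)
  \<comment> \<open>Both claims are instances: the first takes \<open>X = UNIV\<close>, where the
    restriction is \<open>I\<close> itself, and the second takes an arbitrary positive
    \<open>X\<close>.\<close>
  have main: "\<exists>\<A>. \<A> \<subseteq> Pow X \<and> Fin_AD UNIV I \<A> \<and> perfect_in (powerset_topology X) \<A>"
    if X: "X \<notin> I" and meager: "meager_in (powerset_topology X) (ideal_restrict I X)" for X
  proof (rule perfect_almost_disjoint_family[OF _ meager])
    show "infinite X" using X fin by blast
    show "B \<in> ideal_restrict I X" if "A \<in> ideal_restrict I X" "B \<subseteq> A" for A B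
      using that her by (auto simp: ideal_restrict_def)
    fix \<A> assume \<A>: "\<A> \<subseteq> Pow X" "\<A> \<inter> ideal_restrict I X = {}"
      "\<And>A B. A \<in> \<A> \<Longrightarrow> B \<in> \<A> \<Longrightarrow> A \<noteq> B \<Longrightarrow> finite (A \<inter> B)"
      "perfect_in (powerset_topology X) \<A>"
    have "\<A> \<noteq> {}" using \<A>(4) by (simp add: perfect_in_def)
    \<comment> \<open>Members are subsets of \<open>X\<close>, so avoiding the restriction to
      \<open>X\<close> already means avoiding \<open>I\<close>.\<close>
    moreover have "\<A> \<subseteq> positive_sets UNIV I"
      using \<A>(1,2) by (auto simp: positive_sets_def ideal_restrict_def)
    ultimately have "Fin_AD UNIV I \<A>" using \<A>(3) by (simp add: Fin_AD_def)
    with \<A>(1,4) show ?thesis by blast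
  qed
  have UNIV: "UNIV \<notin> I" "ideal_restrict I UNIV = I"
    using assms by (auto simp: ideal_on_def ideal_restrict_def)
  show ?thesis
  proof (intro conjI impI ballI)
    assume "meager_in (powerset_topology UNIV) I"
    then show "\<exists>\<A>. Fin_AD UNIV I \<A> \<and> perfect_in (powerset_topology UNIV) \<A>"
      using main[of UNIV] UNIV by auto
  next
    fix X assume "everywhere_meager UNIV I" "X \<in> positive_sets UNIV I"
    then show "\<exists>\<A>. \<A> \<subseteq> Pow X \<and> Fin_AD UNIV I \<A> \<and> perfect_in (powerset_topology X) \<A>"
      by (intro main) (auto simp: everywhere_meager_def positive_sets_def)
  qed
qed

end
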